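(* Let $G$ be an sp-group such that for every prime $p$ the $p$-component $G_p$ is elementary. Then (the additive group of) $\mathrm{End}_{\mathbb{Z}}(G)$ is an sp-group.
   Context: All groups are abelian. $\mathbb{P}$ is the set of primes. For a group $G$ and a prime $p$, $G_p$ denotes the $p$-component of $G$ (the set of elements whose order is a power of $p$), and $G_t=\bigoplus_{p\in\mathbb{P}}G_p$ is the torsion subgroup. $G_p$ is called elementary if it is a direct sum of cyclic groups of order $p$ (equivalently $pG_p=0$; $G_p=0$ is allowed). A group is reduced if it has no nonzero divisible subgroup, and mixed if it is neither torsion nor torsion-free. A subgroup $H$ of $G$ is pure if $nH=H\cap nG$ for all $n\in\mathbb{N}$. An sp-group is a reduced mixed group $G$ with infinitely many nonzero $p$-components satisfying the following conditions, which are known to be equivalent for such $G$: (1) for every prime $p$, $G=G_p\oplus B_p$ for some group $B_p$ with $pB_p=B_p$; (2) there are embeddings $\bigoplus_p G_p< G\le\prod_p G_p$ and $G$ is a pure subgroup of $\prod_p G_p$; (3) the embeddings in (2) hold and $G/G_t$ is divisible; (4) $G_p$ is a direct summand of $G$ for every prime $p$ and $G/G_t$ is divisible. *)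

theory Defs
  imports "HOL-Algebra.Algebra" "HOL-Computational_Algebra.Primes"
begin

text \<open>
  Abelian groups are \<^locale>\<open>comm_group\<close> structures, written multiplicatively: the
  multiple \<open>n x\<close> is \<open>x [^]\<^bsub>G\<^esub> n\<close> and \<open>0\<close> is \<open>\<one>\<^bsub>G\<^esub>\<close>.
\<close>

text \<open>The function \<open>group.ord\<close> assigns order \<open>0\<close> to elements of infinite order.\<close>

definition torsion_group :: "('a, 'b) monoid_scheme \<Rightarrow> bool" where
  "torsion_group G \<longleftrightarrow> (\<forall>x\<in>carrier G. group.ord G x \<noteq> 0)"

definition torsion_free_group :: "('a, 'b) monoid_scheme \<Rightarrow> bool" where
  "torsion_free_group G \<longleftrightarrow> (\<forall>x\<in>carrier G. group.ord G x \<noteq> 0 \<longrightarrow> x = \<one>\<^bsub>G\<^esub>)"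

definition mixed_group :: "('a, 'b) monoid_scheme \<Rightarrow> bool" where
  "mixed_group G \<longleftrightarrow> \<not> torsion_group G \<and> \<not> torsion_free_group G"

definition divisible_group :: "('a, 'b) monoid_scheme \<Rightarrow> bool" where
  "divisible_group G \<longleftrightarrow>
     (\<forall>n::nat. n > 0 \<longrightarrow> (\<forall>x\<in>carrier G. \<exists>y\<in>carrier G. y [^]\<^bsub>G\<^esub> n = x))"

definition reduced_group :: "('a, 'b) monoid_scheme \<Rightarrow> bool" where
  "reduced_group G \<longleftrightarrow>
     (\<forall>D. subgroup D G \<and> divisible_group (G\<lparr>carrier := D\<rparr>) \<longrightarrow> D = {\<one>\<^bsub>G\<^esub>})"

definition p_component :: "('a, 'b) monoid_scheme \<Rightarrow> nat \<Rightarrow> 'a set" where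
  "p_component G p = {x \<in> carrier G. \<exists>k::nat. group.ord G x = p ^ k}"

definition internal_direct_sum :: "('a, 'b) monoid_scheme \<Rightarrow> 'a set \<Rightarrow> 'a set \<Rightarrow> bool" where
  "internal_direct_sum G A B \<longleftrightarrow>
     subgroup A G \<and> subgroup B G \<and> A \<inter> B = {\<one>\<^bsub>G\<^esub>} \<and> A <#>\<^bsub>G\<^esub> B = carrier G"

text \<open>
  Direct sums of cyclic groups of order \<open>p\<close>. Taking the index set inside the type \<open>'a\<close>
  loses no generality: the generators of the nontrivial summands are distinct elements of \<open>H\<close>.
\<close>

definition elementary_p_group :: "nat \<Rightarrow> ('a, 'b) monoid_scheme \<Rightarrow> bool" where
  "elementary_p_group p H \<longleftrightarrow>
     (\<exists>I::'a set. H \<cong> sum_group I (\<lambda>_. integer_mod_group p))"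

definition sp_group :: "('a, 'b) monoid_scheme \<Rightarrow> bool" where
  "sp_group G \<longleftrightarrow>
     comm_group G \<and> reduced_group G \<and> mixed_group G \<and>
     infinite {p::nat. Factorial_Ring.prime p \<and> p_component G p \<noteq> {\<one>\<^bsub>G\<^esub>}} \<and>
     (\<forall>p::nat. Factorial_Ring.prime p \<longrightarrow>
        (\<exists>B. internal_direct_sum G (p_component G p) B \<and> (\<lambda>x. x [^]\<^bsub>G\<^esub> p) ` B = B))"

text \<open>
  The additive group of the endomorphism ring. Since \<^const>\<open>hom\<close> does not constrain values
  outside the carrier, endomorphisms are taken extensional, so that each of them is
  represented by exactly one HOL function.
\<close>

definition End_group :: "('a, 'b) monoid_scheme \<Rightarrow> ('a \<Rightarrow> 'a) monoid" where
  "End_group G =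
     \<lparr>carrier = hom G G \<inter> extensional (carrier G),
      monoid.mult = (\<lambda>f g. \<lambda>x\<in>carrier G. f x \<otimes>\<^bsub>G\<^esub> g x),
      one = (\<lambda>x\<in>carrier G. \<one>\<^bsub>G\<^esub>)\<rparr>"

end

theory Submission
  imports Defs
begin

text \<open>
  If \<open>G\<^sub>p\<close> is elementary and \<open>G = G\<^sub>p \<oplus> B\<close> with \<open>pB = B\<close>, then \<open>G\<^sub>p = G[p]\<close> and \<open>B = pG\<close>,
  so the decomposition reads \<open>G = G[p] \<oplus> pG\<close>. Multiplication by \<open>p\<close> is then
  bijective on \<open>pG\<close>, and inverting it there gives an endomorphism \<open>\<sigma>\<close> with
  \<open>p(1 - p\<sigma>) = 0\<close>. Writing \<open>f = f(1 - p\<sigma>) + p(f\<sigma>)\<close> shows that \<open>End G\<close> inherits the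
  decomposition \<open>E = E[p] \<oplus> pE\<close>. It is reduced because evaluation at a point maps
  a divisible subgroup of \<open>End G\<close> onto a divisible subgroup of \<open>G\<close>.
\<close>

text \<open>The kernel \<open>G[p]\<close> of multiplication by \<open>p\<close>. A single equation
  cuts it out, so it can be tested pointwise in \<open>End_group G\<close>, unlike
  \<open>p_component\<close>, whose exponent varies with the element.\<close>

definition socle :: "('a, 'b) monoid_scheme \<Rightarrow> nat \<Rightarrow> 'a set" where
  "socle G p = {x \<in> carrier G. x [^]\<^bsub>G\<^esub> p = \<one>\<^bsub>G\<^esub>}"

text \<open>The subgroup \<open>pG\<close>. It depends only on \<open>G\<close> and
  \<open>p\<close>, and so can stand in for a complement \<open>B\<close> that is merely known to
  exist.\<close>

definition multiples :: "('a, 'b) monoid_scheme \<Rightarrow> nat \<Rightarrow> 'a set" where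
  "multiples G p = (\<lambda>x. x [^]\<^bsub>G\<^esub> p) ` carrier G"

text \<open>Each coordinate of a sum of copies of \<open>integer_mod_group p\<close> is killed by
  \<open>p\<close>; injectivity of the isomorphism carries this back to \<open>H\<close>.\<close>

lemma elementary_p_group_pow:
  assumes "group H" "elementary_p_group p H" "x \<in> carrier H"
  shows "x [^]\<^bsub>H\<^esub> p = \<one>\<^bsub>H\<^esub>"
proof -
  obtain I :: "'a set" and h
    where h: "h \<in> iso H (sum_group I (\<lambda>_. integer_mod_group p))"
    using assms(2) unfolding elementary_p_group_def is_iso_def by blast
  let ?S = "sum_group I (\<lambda>_. integer_mod_group p)"
  interpret H: group H by fact
  interpret S: group ?S by simp
  interpret hom: group_hom H ?S h
    using h by unfold_locales (auto simp: iso_def)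
  have hx: "h x \<in> carrier ?S" using assms(3) by simp
  have comp: "(y [^]\<^bsub>?S\<^esub> n) i = y i [^]\<^bsub>integer_mod_group p\<^esub> n"
    if "i \<in> I" "y \<in> carrier ?S" for y i and n :: nat
    using that by (induction n) (auto simp: S.nat_pow_closed)
  have "h x [^]\<^bsub>?S\<^esub> p = \<one>\<^bsub>?S\<^esub>"
  proof
    fix i
    \<comment> \<open>Elements of \<open>sum_group\<close> are extensional, so outside
      \<open>I\<close> both sides are \<open>undefined\<close>.\<close>
    have ext: "y \<in> extensional I" if "y \<in> carrier ?S" for y
      using that by (auto simp: carrier_sum_group PiE_def)
    show "(h x [^]\<^bsub>?S\<^esub> p) i = \<one>\<^bsub>?S\<^esub> i"
    proof (cases "i \<in> I")
      case True
      then show ?thesis using hx comp[of i "h x" p]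
        by (simp add: pow_integer_mod_group)
    next
      case False
      then show ?thesis
        using ext[OF S.nat_pow_closed[OF hx, of p], THEN extensional_arb]
          ext[OF S.one_closed, THEN extensional_arb] by metis
    qed
  qed
  then have "h (x [^]\<^bsub>H\<^esub> p) = h \<one>\<^bsub>H\<^esub>"
    using assms(3) by (simp add: hom.hom_nat_pow)
  moreover have "inj_on h (carrier H)" using h by (simp add: iso_def bij_betw_def)
  ultimately show ?thesis using assms(3) by (meson H.nat_pow_closed H.one_closed inj_onD)
qed

section \<open>The decomposition of \<open>G\<close> into \<open>G[p]\<close> and
  \<open>pG\<close>\<close>

context comm_group
begin

lemma subgroup_socle: "subgroup (socle G p) G"
  by (rule subgroupI) (auto simp: socle_def nat_pow_distrib nat_pow_inv intro: exI[of _ \<one>])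

lemma subgroup_multiples: "subgroup (multiples G p) G"
proof (rule subgroupI)
  fix a b assume "a \<in> multiples G p"
  then obtain x where x: "x \<in> carrier G" "a = x [^] p" by (auto simp: multiples_def)
  then show "inv a \<in> multiples G p"
    using nat_pow_inv[of x p] by (auto simp: multiples_def intro!: image_eqI[of _ _ "inv x"])
  assume "b \<in> multiples G p"
  then obtain y where "y \<in> carrier G" "b = y [^] p" by (auto simp: multiples_def)
  then show "a \<otimes> b \<in> multiples G p"
    using x nat_pow_distrib[of x y p]
    by (auto simp: multiples_def intro!: image_eqI[of _ _ "x \<otimes> y"])
qed (auto simp: multiples_def)

lemma socle_subset_p_component:
  assumes "Factorial_Ring.prime p"
  shows "socle G p \<subseteq> p_component G p"
proof
  fix x assume "x \<in> socle G p"
  then have x: "x \<in> carrier G" "x [^] p = \<one>" by (auto simp: socle_def)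
  then have "ord x dvd p" using pow_eq_id by blast
  then have "ord x = 1 \<or> ord x = p" using assms by (auto simp: prime_nat_iff)
  then have "\<exists>k. ord x = p ^ k" by (metis power_0 power_one_right)
  with x(1) show "x \<in> p_component G p" by (simp add: p_component_def)
qed

text \<open>Since \<open>p\<close> kills the \<open>p\<close>-component, that component is exactly
  \<open>G[p]\<close>; and as \<open>p\<close> annihilates this part of every element,
  \<open>pG = pB = B\<close>.\<close>

lemma direct_sum_socle_multiples:
  assumes p: "Factorial_Ring.prime p"
    and elem: "\<And>x. x \<in> p_component G p \<Longrightarrow> x [^] p = \<one>"
    and sum: "internal_direct_sum G (p_component G p) B"
    and B: "(\<lambda>x. x [^] p) ` B = B"
  shows "internal_direct_sum G (socle G p) (multiples G p)"
proof -
  have "p_component G p = socle G p"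
    using elem socle_subset_p_component[OF p] by (auto simp: socle_def p_component_def)
  with sum have sum': "internal_direct_sum G (socle G p) B" by simp
  then have sub: "B \<subseteq> carrier G"
    by (simp add: internal_direct_sum_def subgroup.subset)
  have "x [^] p \<in> B" if "x \<in> carrier G" for x
  proof -
    have "x \<in> socle G p <#> B" using that sum' by (simp add: internal_direct_sum_def)
    then obtain a b where ab: "a \<in> socle G p" "b \<in> B" "x = a \<otimes> b"
      by (auto simp: set_mult_def)
    then have "x [^] p = b [^] p"
      using sub by (auto simp: socle_def nat_pow_distrib subsetD)
    then show ?thesis using ab B by auto
  qed
  moreover have "B \<subseteq> multiples G p" using image_mono[OF sub, of "\<lambda>x. x [^] p"] B by (simp add: multiples_def)
  ultimately have "multiples G p = B" by (auto simp: multiples_def)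
  with sum' show ?thesis by simp
qed

text \<open>If \<open>p^(k+1) x = 0\<close> with \<open>k > 0\<close>, then \<open>p^k x\<close>
  lies in both \<open>G[p]\<close> and \<open>pG\<close>, hence is zero, and the exponent drops
  until it is 1. This yields the components of \<open>End_group G\<close>, which are not assumed
  elementary.\<close>

lemma p_component_eq_socle:
  assumes p: "Factorial_Ring.prime p"
    and disj: "socle G p \<inter> multiples G p = {\<one>}"
  shows "p_component G p = socle G p"
proof
  have *: "x [^] p = \<one>" if "x \<in> carrier G" "x [^] (p ^ k) = \<one>" for x k
    using that(2)
  proof (induction k)
    case 0
    then show ?case using that(1) by simp
  next
    case (Suc k)
    show ?case
    \<comment> \<open>For \<open>k = 0\<close> the exponent is already \<open>p\<close>; only for
      \<open>k > 0\<close> is \<open>p^k x\<close> visibly a multiple of \<open>p\<close>.\<close>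
    proof (cases k)
      case 0
      then show ?thesis using Suc.prems by simp
    next
      case (Suc j)
      let ?y = "x [^] (p ^ k)"
      have "?y = (x [^] (p ^ j)) [^] p"
        using that(1) Suc by (simp add: nat_pow_pow mult.commute)
      then have "?y \<in> multiples G p" using that(1) by (auto simp: multiples_def)
      moreover have "?y \<in> socle G p"
        using that(1) Suc.prems by (simp add: socle_def nat_pow_pow mult.commute)
      ultimately have "?y = \<one>" using disj by blast
      then show ?thesis by (rule Suc.IH)
    qed
  qed
  show "p_component G p \<subseteq> socle G p"
  proof
    fix x assume "x \<in> p_component G p"
    then obtain k where k: "x \<in> carrier G" "ord x = p ^ k" by (auto simp: p_component_def)
    then have "x [^] (p ^ k) = \<one>" using pow_ord_eq_1[of x] by simp
    with * k(1) show "x \<in> socle G p" by (auto simp: socle_def)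
  qed
qed (rule socle_subset_p_component[OF p])

text \<open>If \<open>x = a + b\<close> along the two summands, then \<open>px = pb\<close> with
  \<open>b\<close> already in \<open>pG\<close>.\<close>

lemma pow_image_multiples:
  assumes "socle G p <#> multiples G p = carrier G"
  shows "(\<lambda>x. x [^] p) ` multiples G p = multiples G p"
proof
  have sub: "multiples G p \<subseteq> carrier G" by (auto simp: multiples_def)
  then show "(\<lambda>x. x [^] p) ` multiples G p \<subseteq> multiples G p"
    unfolding multiples_def by auto
  show "multiples G p \<subseteq> (\<lambda>x. x [^] p) ` multiples G p"
  proof
    fix y assume "y \<in> multiples G p"
    then obtain x where x: "x \<in> carrier G" "y = x [^] p" by (auto simp: multiples_def)
    then have "x \<in> socle G p <#> multiples G p" using assms by simp
    then obtain a b where ab: "a \<in> socle G p" "b \<in> multiples G p" "x = a \<otimes> b"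
      by (auto simp: set_mult_def)
    then have "y = b [^] p"
      using sub x by (auto simp: socle_def nat_pow_distrib subsetD)
    with ab(2) show "y \<in> (\<lambda>x. x [^] p) ` multiples G p" by blast
  qed
qed

section \<open>Inverting \<open>p\<close> on \<open>pG\<close>\<close>

text \<open>Multiplication by \<open>p\<close> is onto on \<open>pG\<close> by
  \<open>pow_image_multiples\<close>, and injective there because \<open>G[p]\<close> meets
  \<open>pG\<close> trivially. The map \<open>\<sigma>\<close> is the projection onto
  \<open>pG\<close> followed by the inverse of this bijection.\<close>

lemma exists_partial_inverse:
  assumes "internal_direct_sum G (socle G p) (multiples G p)"
  obtains \<sigma> where "\<sigma> \<in> hom G G"
    and "\<And>x. x \<in> carrier G \<Longrightarrow> x \<otimes> inv (\<sigma> x [^] p) \<in> socle G p"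
proof -
  let ?A = "socle G p" and ?B = "multiples G p"
  interpret A: subgroup ?A G by (rule subgroup_socle)
  interpret B: subgroup ?B G by (rule subgroup_multiples)
  have disj: "?A \<inter> ?B = {\<one>}" and span: "?A <#> ?B = carrier G"
    using assms by (auto simp: internal_direct_sum_def)
  have ex: "\<exists>y\<in>?B. x \<otimes> inv (y [^] p) \<in> ?A" if x: "x \<in> carrier G" for x
  proof -
    have "x \<in> ?A <#> ?B" using span x by simp
    then obtain a b where ab: "a \<in> ?A" "b \<in> ?B" "x = a \<otimes> b"
      by (auto simp: set_mult_def)
    obtain y where y: "y \<in> ?B" "b = y [^] p"
      using ab(2) pow_image_multiples[OF span] by blast
    have "x \<otimes> inv (y [^] p) = a" using ab y by (simp add: m_assoc)
    with ab(1) y(1) show ?thesis by auto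
  qed
  \<comment> \<open>For \<open>w = y - z\<close> in \<open>pG\<close> the trivial intersection is
    used twice: first on \<open>pw\<close>, then, once \<open>pw = 0\<close> puts \<open>w\<close>
    in \<open>G[p]\<close>, on \<open>w\<close> itself.\<close>
  have uniq: "y = z"
    if x: "x \<in> carrier G" and y: "y \<in> ?B" "x \<otimes> inv (y [^] p) \<in> ?A"
      and z: "z \<in> ?B" "x \<otimes> inv (z [^] p) \<in> ?A" for x y z
  proof -
    let ?w = "y \<otimes> inv z"
    have c: "y \<in> carrier G" "z \<in> carrier G" using y z by auto
    have wB: "?w \<in> ?B" using y z by simp
    have "(x \<otimes> inv (z [^] p)) \<otimes> inv (x \<otimes> inv (y [^] p)) \<in> ?A" using y z by simp
    also have "(x \<otimes> inv (z [^] p)) \<otimes> inv (x \<otimes> inv (y [^] p))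
        = x \<otimes> (inv x \<otimes> (y [^] p \<otimes> inv (z [^] p)))"
      using x c by (simp add: inv_mult_group m_ac)
    also have "\<dots> = ?w [^] p"
      using x c by (simp add: m_assoc[symmetric] nat_pow_distrib nat_pow_inv)
    finally have "?w [^] p \<in> ?A" .
    moreover have "?w [^] p \<in> ?B" using wB by (auto simp: multiples_def)
    ultimately have "?w [^] p = \<one>" using disj by blast
    then have "?w \<in> ?A" using B.mem_carrier[OF wB] unfolding socle_def by blast
    with wB disj have "?w = \<one>" by blast
    then show ?thesis using inv_equality[of y "inv z"] c by simp
  qed
  define \<sigma> where "\<sigma> x = (SOME y. y \<in> ?B \<and> x \<otimes> inv (y [^] p) \<in> ?A)" for x
  have \<sigma>: "\<sigma> x \<in> ?B \<and> x \<otimes> inv (\<sigma> x [^] p) \<in> ?A" if "x \<in> carrier G" for x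
    unfolding \<sigma>_def using someI_ex[of "\<lambda>y. y \<in> ?B \<and> x \<otimes> inv (y [^] p) \<in> ?A"] ex[OF that]
    by blast
  \<comment> \<open>Additivity comes from \<open>uniq\<close>:
    \<open>\<sigma> x + \<sigma> y\<close> meets the condition that determines
    \<open>\<sigma> (x + y)\<close>.\<close>
  have "\<sigma> \<in> hom G G"
  proof (rule homI)
    fix x y assume xy: "x \<in> carrier G" "y \<in> carrier G"
    have c: "\<sigma> x \<in> carrier G" "\<sigma> y \<in> carrier G" using \<sigma> xy by auto
    have "(x \<otimes> inv (\<sigma> x [^] p)) \<otimes> (y \<otimes> inv (\<sigma> y [^] p)) \<in> ?A" using \<sigma> xy by simp
    also have "(x \<otimes> inv (\<sigma> x [^] p)) \<otimes> (y \<otimes> inv (\<sigma> y [^] p))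
        = (x \<otimes> y) \<otimes> inv ((\<sigma> x \<otimes> \<sigma> y) [^] p)"
      using xy c by (simp add: nat_pow_distrib inv_mult_group m_ac)
    finally show "\<sigma> (x \<otimes> y) = \<sigma> x \<otimes> \<sigma> y"
      using uniq[of "x \<otimes> y" "\<sigma> (x \<otimes> y)" "\<sigma> x \<otimes> \<sigma> y"] \<sigma> xy by simp
  qed (use \<sigma> in auto)
  with \<sigma> that show thesis by blast
qed

section \<open>The group of endomorphisms\<close>

lemma End_group_carrierI:
  assumes "f \<in> hom G G"
  shows "restrict f (carrier G) \<in> carrier (End_group G)"
  using assms by (auto simp: End_group_def hom_def Pi_iff)

lemma End_group_eqI:
  assumes "f \<in> carrier (End_group G)" "g \<in> carrier (End_group G)"
    and "\<And>x. x \<in> carrier G \<Longrightarrow> f x = g x"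
  shows "f = g"
  using assms by (auto simp: End_group_def intro: extensionalityI)

lemma End_group_closed:
  "f \<in> carrier (End_group G) \<Longrightarrow> x \<in> carrier G \<Longrightarrow> f x \<in> carrier G"
  by (auto simp: End_group_def hom_def)

lemma End_group_mult_apply:
  "x \<in> carrier G \<Longrightarrow> (f \<otimes>\<^bsub>End_group G\<^esub> g) x = f x \<otimes> g x"
  by (simp add: End_group_def)

lemma End_group_one_apply:
  "x \<in> carrier G \<Longrightarrow> \<one>\<^bsub>End_group G\<^esub> x = \<one>"
  by (simp add: End_group_def)

text \<open>Commutativity of \<open>G\<close> is what makes pointwise sums and inverses of
  homomorphisms homomorphisms again; the group laws are then inherited pointwise.\<close>

lemma comm_group_End_group: "comm_group (End_group G)"
proof (rule comm_groupI)
  show "\<one>\<^bsub>End_group G\<^esub> \<in> carrier (End_group G)"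
    by (auto simp: End_group_def hom_def)
  show mult: "f \<otimes>\<^bsub>End_group G\<^esub> g \<in> carrier (End_group G)"
    if "f \<in> carrier (End_group G)" "g \<in> carrier (End_group G)" for f g
    using that by (auto simp: End_group_def hom_def Pi_iff m_ac)
  show "(f \<otimes>\<^bsub>End_group G\<^esub> g) \<otimes>\<^bsub>End_group G\<^esub> h
      = f \<otimes>\<^bsub>End_group G\<^esub> (g \<otimes>\<^bsub>End_group G\<^esub> h)"
    if "f \<in> carrier (End_group G)" "g \<in> carrier (End_group G)" "h \<in> carrier (End_group G)"
    for f g h
    using that by (intro End_group_eqI mult)
      (auto simp: End_group_mult_apply End_group_closed m_assoc)
  show "f \<otimes>\<^bsub>End_group G\<^esub> g = g \<otimes>\<^bsub>End_group G\<^esub> f"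
    if "f \<in> carrier (End_group G)" "g \<in> carrier (End_group G)" for f g
    using that by (intro End_group_eqI mult)
      (auto simp: End_group_mult_apply End_group_closed m_comm)
  show "\<one>\<^bsub>End_group G\<^esub> \<otimes>\<^bsub>End_group G\<^esub> f = f" if "f \<in> carrier (End_group G)" for f
    using that \<open>\<one>\<^bsub>End_group G\<^esub> \<in> carrier (End_group G)\<close>
    by (intro End_group_eqI mult)
      (auto simp: End_group_mult_apply End_group_one_apply End_group_closed)
  show "\<exists>g\<in>carrier (End_group G). g \<otimes>\<^bsub>End_group G\<^esub> f = \<one>\<^bsub>End_group G\<^esub>"
    if f: "f \<in> carrier (End_group G)" for f
  proof
    show g: "(\<lambda>x\<in>carrier G. inv (f x)) \<in> carrier (End_group G)"
      using f by (auto simp: End_group_def hom_def Pi_iff inv_mult_group m_comm)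
    show "(\<lambda>x\<in>carrier G. inv (f x)) \<otimes>\<^bsub>End_group G\<^esub> f = \<one>\<^bsub>End_group G\<^esub>"
      using f g \<open>\<one>\<^bsub>End_group G\<^esub> \<in> carrier (End_group G)\<close>
      by (intro End_group_eqI mult)
        (auto simp: End_group_mult_apply End_group_one_apply End_group_closed)
  qed
qed

text \<open>Evaluation at a point lets powers in \<open>End_group G\<close> be computed pointwise
  and carries subgroups of \<open>End_group G\<close> to subgroups of \<open>G\<close>.\<close>

lemma group_hom_End_group_apply:
  assumes "x \<in> carrier G"
  shows "group_hom (End_group G) G (\<lambda>f. f x)"
proof -
  interpret E: comm_group "End_group G" by (rule comm_group_End_group)
  show ?thesis
    by unfold_locales
      (use assms in \<open>auto simp: hom_def End_group_mult_apply End_group_closed\<close>)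
qed

lemma End_group_pow_apply:
  assumes "f \<in> carrier (End_group G)" "x \<in> carrier G"
  shows "(f [^]\<^bsub>End_group G\<^esub> (n::nat)) x = f x [^] n"
proof -
  interpret group_hom "End_group G" G "\<lambda>f. f x"
    using assms(2) by (rule group_hom_End_group_apply)
  show ?thesis using hom_nat_pow[OF assms(1)] by simp
qed

lemma socle_End_group_iff:
  assumes "f \<in> carrier (End_group G)"
  shows "f \<in> socle (End_group G) p \<longleftrightarrow> (\<forall>x\<in>carrier G. f x \<in> socle G p)"
proof -
  interpret E: comm_group "End_group G" by (rule comm_group_End_group)
  have "f [^]\<^bsub>End_group G\<^esub> p = \<one>\<^bsub>End_group G\<^esub> \<longleftrightarrow> (\<forall>x\<in>carrier G. f x [^] p = \<one>)"
  proof
    assume "f [^]\<^bsub>End_group G\<^esub> p = \<one>\<^bsub>End_group G\<^esub>"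
    then show "\<forall>x\<in>carrier G. f x [^] p = \<one>"
      using End_group_pow_apply[OF assms] End_group_one_apply by metis
  next
    assume "\<forall>x\<in>carrier G. f x [^] p = \<one>"
    then show "f [^]\<^bsub>End_group G\<^esub> p = \<one>\<^bsub>End_group G\<^esub>"
      using assms
      by (intro End_group_eqI) (auto simp: End_group_pow_apply End_group_one_apply)
  qed
  then show ?thesis using assms by (auto simp: socle_def End_group_closed)
qed

section \<open>Transfer of the decomposition to endomorphisms\<close>

text \<open>Taking \<open>\<pi> = 1 - p\<sigma>\<close> writes the identity as
  \<open>\<pi> + p\<sigma>\<close>, a form that can be composed with any endomorphism.\<close>

lemma exists_splitting:
  assumes "internal_direct_sum G (socle G p) (multiples G p)"
  obtains \<pi> \<sigma> where "\<pi> \<in> hom G G" "\<sigma> \<in> hom G G"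
    and "\<And>x. x \<in> carrier G \<Longrightarrow> \<pi> x \<in> socle G p"
    and "\<And>x. x \<in> carrier G \<Longrightarrow> x = \<pi> x \<otimes> \<sigma> x [^] p"
proof -
  obtain \<sigma> where \<sigma>: "\<sigma> \<in> hom G G"
    and s: "\<And>x. x \<in> carrier G \<Longrightarrow> x \<otimes> inv (\<sigma> x [^] p) \<in> socle G p"
    using exists_partial_inverse[OF assms] by blast
  have c: "\<And>x. x \<in> carrier G \<Longrightarrow> \<sigma> x \<in> carrier G"
    and m: "\<And>x y. x \<in> carrier G \<Longrightarrow> y \<in> carrier G \<Longrightarrow> \<sigma> (x \<otimes> y) = \<sigma> x \<otimes> \<sigma> y"
    using \<sigma> by (auto simp: hom_def)
  show thesis
  proof
    show "(\<lambda>x. x \<otimes> inv (\<sigma> x [^] p)) \<in> hom G G"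
      by (rule homI) (auto simp: c m nat_pow_distrib inv_mult_group m_ac)
    show "x = (x \<otimes> inv (\<sigma> x [^] p)) \<otimes> \<sigma> x [^] p" if "x \<in> carrier G" for x
      using that c by (simp add: m_assoc)
  qed (use \<sigma> s in auto)
qed

lemma End_group_direct_sum:
  assumes sum: "internal_direct_sum G (socle G p) (multiples G p)"
  shows "internal_direct_sum (End_group G) (socle (End_group G) p) (multiples (End_group G) p)"
proof -
  let ?E = "End_group G"
  interpret E: comm_group ?E by (rule comm_group_End_group)
  \<comment> \<open>Every value of such an \<open>f\<close> lies in both \<open>G[p]\<close> and
    \<open>pG\<close>.\<close>
  have disj: "f = \<one>\<^bsub>?E\<^esub>" if f: "f \<in> socle ?E p" "f \<in> multiples ?E p" for f
  proof -
    obtain g where g: "g \<in> carrier ?E" "f = g [^]\<^bsub>?E\<^esub> p"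
      using f(2) by (auto simp: multiples_def)
    have fc: "f \<in> carrier ?E" using g by simp
    have "f x = \<one>" if x: "x \<in> carrier G" for x
    proof -
      have "f x \<in> multiples G p"
        using g x by (auto simp: End_group_pow_apply multiples_def End_group_closed)
      moreover have "f x \<in> socle G p" using f(1) fc x socle_End_group_iff by blast
      ultimately show ?thesis using sum by (auto simp: internal_direct_sum_def)
    qed
    then show ?thesis using fc by (intro End_group_eqI) (auto simp: End_group_one_apply)
  qed
  obtain \<pi> \<sigma> where \<pi>: "\<pi> \<in> hom G G" and \<sigma>: "\<sigma> \<in> hom G G"
    and soc: "\<And>x. x \<in> carrier G \<Longrightarrow> \<pi> x \<in> socle G p"
    and split: "\<And>x. x \<in> carrier G \<Longrightarrow> x = \<pi> x \<otimes> \<sigma> x [^] p"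
    using exists_splitting[OF sum] by blast
  have span: "f \<in> socle ?E p <#>\<^bsub>?E\<^esub> multiples ?E p" if f: "f \<in> carrier ?E" for f
  proof -
    have fh: "f \<in> hom G G" using f by (simp add: End_group_def)
    interpret f: group_hom G G f using fh by unfold_locales
    have \<pi>c: "\<pi> x \<in> carrier G" and \<sigma>c: "\<sigma> x \<in> carrier G" if "x \<in> carrier G" for x
      using \<pi> \<sigma> that by (auto simp: hom_def)
    \<comment> \<open>The two parts of \<open>f = f\<pi> + p(f\<sigma>)\<close>, restricted to the
      carrier so that they are extensional.\<close>
    let ?a = "\<lambda>x\<in>carrier G. f (\<pi> x)" and ?b = "\<lambda>x\<in>carrier G. f (\<sigma> x)"
    have a: "?a \<in> carrier ?E" and b: "?b \<in> carrier ?E"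
      using End_group_carrierI[OF Group.hom_compose[OF \<pi> fh]]
        End_group_carrierI[OF Group.hom_compose[OF \<sigma> fh]] by (simp_all add: comp_def)
    \<comment> \<open>Homomorphisms preserve the equation \<open>px = 0\<close>, so \<open>f\<close>
      maps \<open>G[p]\<close> into itself.\<close>
    have "f (\<pi> x) \<in> socle G p" if "x \<in> carrier G" for x
      using soc[OF that] by (auto simp: socle_def f.hom_nat_pow[symmetric])
    then have "?a \<in> socle ?E p" using a by (simp add: socle_End_group_iff)
    moreover have "?b [^]\<^bsub>?E\<^esub> p \<in> multiples ?E p" using b by (auto simp: multiples_def)
    moreover have "f = ?a \<otimes>\<^bsub>?E\<^esub> (?b [^]\<^bsub>?E\<^esub> p)"
    proof (rule End_group_eqI[OF f])
      fix x assume x: "x \<in> carrier G"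
      have "f x = f (\<pi> x \<otimes> \<sigma> x [^] p)" using split[OF x] by simp
      also have "\<dots> = f (\<pi> x) \<otimes> f (\<sigma> x) [^] p"
        using x \<pi>c \<sigma>c by (simp add: f.hom_nat_pow)
      finally show "f x = (?a \<otimes>\<^bsub>?E\<^esub> (?b [^]\<^bsub>?E\<^esub> p)) x"
        using x b by (simp add: End_group_mult_apply End_group_pow_apply)
    qed (use a b in simp)
    ultimately show ?thesis by (auto simp: set_mult_def)
  qed
  have sub: "subgroup (socle ?E p) ?E" "subgroup (multiples ?E p) ?E"
    by (rule E.subgroup_socle E.subgroup_multiples)+
  moreover have "socle ?E p \<inter> multiples ?E p = {\<one>\<^bsub>?E\<^esub>}"
    using disj sub[THEN subgroup.one_closed] by blast
  moreover have "socle ?E p <#>\<^bsub>?E\<^esub> multiples ?E p = carrier ?E"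
    using span E.set_mult_closed[OF sub[THEN subgroup.subset]] by blast
  ultimately show ?thesis by (simp add: internal_direct_sum_def)
qed

text \<open>The witness is \<open>\<pi>\<close>: its values lie in \<open>G[p]\<close>, and it fixes
  each \<open>a\<close> in \<open>G[p]\<close> because
  \<open>p\<sigma>(a) = \<sigma>(pa) = 0\<close>.\<close>

lemma socle_End_group_nontrivial:
  assumes sum: "internal_direct_sum G (socle G p) (multiples G p)"
    and nt: "socle G p \<noteq> {\<one>}"
  shows "socle (End_group G) p \<noteq> {\<one>\<^bsub>End_group G\<^esub>}"
proof -
  obtain \<pi> \<sigma> where \<pi>: "\<pi> \<in> hom G G" and \<sigma>: "\<sigma> \<in> hom G G"
    and soc: "\<And>x. x \<in> carrier G \<Longrightarrow> \<pi> x \<in> socle G p"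
    and split: "\<And>x. x \<in> carrier G \<Longrightarrow> x = \<pi> x \<otimes> \<sigma> x [^] p"
    using exists_splitting[OF sum] by blast
  interpret \<sigma>: group_hom G G \<sigma> using \<sigma> by unfold_locales
  obtain a where a: "a \<in> socle G p" "a \<noteq> \<one>"
    using nt subgroup.one_closed[OF subgroup_socle] by blast
  then have ac: "a \<in> carrier G" "a [^] p = \<one>" by (auto simp: socle_def)
  have "\<sigma> a [^] p = \<one>" using ac \<sigma>.hom_nat_pow[of a p] by simp
  moreover have "\<pi> a \<in> carrier G" using ac \<pi> by (auto simp: hom_def)
  ultimately have "\<pi> a = a" using split[OF ac(1)] by simp
  then have "restrict \<pi> (carrier G) \<noteq> \<one>\<^bsub>End_group G\<^esub>"
    using a ac End_group_one_apply[OF ac(1)] by (metis restrict_apply')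
  moreover have "restrict \<pi> (carrier G) \<in> socle (End_group G) p"
    using End_group_carrierI[OF \<pi>] soc by (simp add: socle_End_group_iff)
  ultimately show ?thesis by blast
qed

section \<open>Reducedness and torsion of the endomorphism group\<close>

lemma reduced_End_group:
  assumes "reduced_group G"
  shows "reduced_group (End_group G)"
  unfolding reduced_group_def
proof (intro allI impI)
  let ?E = "End_group G"
  interpret E: comm_group ?E by (rule comm_group_End_group)
  fix D assume D: "subgroup D ?E \<and> divisible_group (?E\<lparr>carrier := D\<rparr>)"
  then interpret D: subgroup D ?E by simp
  \<comment> \<open>Powers in the subgroup \<open>D\<close> agree with those in \<open>?E\<close>,
    so the roots provided by divisibility of \<open>D\<close> are roots in
    \<open>?E\<close>.\<close>
  have div: "\<exists>g\<in>D. g [^]\<^bsub>?E\<^esub> n = f" if "n > 0" "f \<in> D" for n :: nat and f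
    using D that E.nat_pow_consistent[of _ n D] by (auto simp: divisible_group_def)
  have zero: "f x = \<one>" if f: "f \<in> D" and x: "x \<in> carrier G" for f x
  proof -
    interpret ev: group_hom ?E G "\<lambda>f. f x" using x by (rule group_hom_End_group_apply)
    let ?D = "(\<lambda>f. f x) ` D"
    have "subgroup ?D G" by (rule ev.subgroup_img_is_subgroup) unfold_locales
    moreover have "divisible_group (G\<lparr>carrier := ?D\<rparr>)"
      unfolding divisible_group_def
    proof (intro allI impI ballI)
      fix n :: nat and y assume n: "n > 0" and "y \<in> carrier (G\<lparr>carrier := ?D\<rparr>)"
      then obtain h where h: "h \<in> D" "y = h x" by auto
      then obtain g where g: "g \<in> D" "g [^]\<^bsub>?E\<^esub> n = h" using div n by blast
      then have "g x [^] n = y" using x h End_group_pow_apply[of g x n] by auto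
      then show "\<exists>z\<in>carrier (G\<lparr>carrier := ?D\<rparr>). z [^]\<^bsub>G\<lparr>carrier := ?D\<rparr>\<^esub> n = y"
        using g(1) nat_pow_consistent[of _ n ?D] by auto
    qed
    ultimately have "?D = {\<one>}" using assms by (simp add: reduced_group_def)
    then show ?thesis using f by blast
  qed
  have "f = \<one>\<^bsub>?E\<^esub>" if "f \<in> D" for f
    using that zero by (intro End_group_eqI) (auto simp: End_group_one_apply)
  then show "D = {\<one>\<^bsub>?E\<^esub>}" using D.one_closed by blast
qed

text \<open>A multiple that kills the identity endomorphism kills every element of \<open>G\<close>,
  so a finite order of the identity bounds all orders in \<open>G\<close>.\<close>

lemma torsion_group_if_End_group:
  assumes "torsion_group (End_group G)"
  shows "torsion_group G"
  unfolding torsion_group_def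
proof
  interpret E: comm_group "End_group G" by (rule comm_group_End_group)
  let ?i = "\<lambda>x\<in>carrier G. x"
  have i: "?i \<in> carrier (End_group G)" by (rule End_group_carrierI) (simp add: hom_def)
  fix x assume x: "x \<in> carrier G"
  have "x [^] E.ord ?i = (?i [^]\<^bsub>End_group G\<^esub> E.ord ?i) x"
    using End_group_pow_apply[OF i x] x by simp
  also have "\<dots> = \<one>" using E.pow_ord_eq_1[OF i] x by (simp add: End_group_one_apply)
  finally have "ord x dvd E.ord ?i" using x by (simp add: pow_eq_id)
  moreover have "E.ord ?i \<noteq> 0" using assms i by (simp add: torsion_group_def)
  ultimately show "ord x \<noteq> 0" by auto
qed

end

section \<open>The conditions of an sp-group for \<open>End_group G\<close>\<close>

theorem proposition3:
  fixes G :: "('a, 'b) monoid_scheme"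
  assumes "sp_group G"
    and "\<And>p::nat. Factorial_Ring.prime p \<Longrightarrow> elementary_p_group p (G\<lparr>carrier := p_component G p\<rparr>)"
  shows "sp_group (End_group G)"
proof -
  interpret comm_group G using assms(1) by (simp add: sp_group_def)
  let ?E = "End_group G"
  interpret E: comm_group ?E by (rule comm_group_End_group)
  have sum: "internal_direct_sum G (socle G p) (multiples G p)"
    if p: "Factorial_Ring.prime p" for p
  proof -
    obtain B where B: "internal_direct_sum G (p_component G p) B" "(\<lambda>x. x [^]\<^bsub>G\<^esub> p) ` B = B"
      using assms(1) p by (auto simp: sp_group_def)
    \<comment> \<open>The elementary hypothesis concerns the component as a group of its own, whose
      powers must be identified with those of \<open>G\<close>.\<close>
    have "group (G\<lparr>carrier := p_component G p\<rparr>)"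
      using B(1) subgroup_imp_group by (auto simp: internal_direct_sum_def)
    then have "x [^]\<^bsub>G\<^esub> p = \<one>\<^bsub>G\<^esub>" if "x \<in> p_component G p" for x
      using elementary_p_group_pow[OF _ assms(2)[OF p]] that
        nat_pow_consistent[of x p "p_component G p"] by simp
    with B p show ?thesis by (intro direct_sum_socle_multiples)
  qed
  have sumE: "internal_direct_sum ?E (socle ?E p) (multiples ?E p)"
    if "Factorial_Ring.prime p" for p
    using End_group_direct_sum sum that by blast
  have comp: "p_component G p = socle G p" "p_component ?E p = socle ?E p"
    if "Factorial_Ring.prime p" for p
    using p_component_eq_socle E.p_component_eq_socle sum sumE that
    by (auto simp: internal_direct_sum_def)
  let ?P = "\<lambda>p. Factorial_Ring.prime p \<and> p_component G p \<noteq> {\<one>\<^bsub>G\<^esub>}"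
  have nontriv: "p_component ?E p \<noteq> {\<one>\<^bsub>?E\<^esub>}" if "?P p" for p
    using that comp sum socle_End_group_nontrivial by metis
  have inf: "infinite {p. ?P p}" using assms(1) by (simp add: sp_group_def)
  \<comment> \<open>The primes with nonzero component in \<open>G\<close> form an infinite subset of
    those for \<open>?E\<close>.\<close>
  then have infE: "infinite {p::nat. Factorial_Ring.prime p \<and> p_component ?E p \<noteq> {\<one>\<^bsub>?E\<^esub>}}"
    by (rule contrapos_nn) (rule finite_subset[rotated], use nontriv in auto)
  have "\<not> torsion_free_group ?E"
  proof -
    \<comment> \<open>One nonzero component is enough: it gives a nonzero endomorphism whose order
      \<open>p ^ k\<close> is nonzero, hence finite.\<close>
    have "{p. ?P p} \<noteq> {}" using inf by (rule contrapos_nn) (simp only: finite.emptyI)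
    then obtain p where p: "?P p" by blast
    have "\<one>\<^bsub>?E\<^esub> \<in> p_component ?E p"
      using comp(2) p subgroup.one_closed[OF E.subgroup_socle] by auto
    then obtain f where f: "f \<in> p_component ?E p" "f \<noteq> \<one>\<^bsub>?E\<^esub>"
      using nontriv[OF p] by blast
    then have "f \<in> carrier ?E" "E.ord f \<noteq> 0" using p by (auto simp: p_component_def)
    with f(2) show ?thesis by (auto simp: torsion_free_group_def)
  qed
  moreover have "\<not> torsion_group ?E"
    using assms(1) torsion_group_if_End_group by (auto simp: sp_group_def mixed_group_def)
  \<comment> \<open>The complement is \<open>pE\<close>, on which \<open>p\<close> acts surjectively
    because the two summands span \<open>?E\<close>.\<close>
  moreover have "\<exists>B. internal_direct_sum ?E (p_component ?E p) B \<and> (\<lambda>f. f [^]\<^bsub>?E\<^esub> p) ` B = B"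
    if "Factorial_Ring.prime p" for p
    using sumE[OF that] comp(2)[OF that] E.pow_image_multiples[of p]
    by (intro exI[of _ "multiples ?E p"]) (simp add: internal_direct_sum_def)
  moreover have "reduced_group ?E"
    using assms(1) reduced_End_group by (simp add: sp_group_def)
  ultimately show ?thesis
    using infE E.comm_group_axioms by (simp add: sp_group_def mixed_group_def)
qed

end
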